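(* Let $m,g,t\ge 1$ be integers. Under the identification of a ruler $(x_0,\dots,x_m)$ with its vector of successive differences $\mathbf{z}=(z_1,\dots,z_m)$, $z_i=x_i-x_{i-1}$, the $B_2[g]$-sets with $m+1$ markings and length $t$ are in bijection with the lattice points (points of $\mathbb{Z}^m$) in the interior of $t\Delta_{m-1}$ that are not contained in any subspace of the form $$\sum_{i=r_g+1}^{r_0}z_i=\sum_{i=\ell_0+1}^{\ell_1}z_i+\sum_{i=r_g+1}^{r_1}z_i=\cdots=\sum_{i=\ell_0+1}^{\ell_k}z_i+\sum_{i=r_g+1}^{r_k}z_i=\cdots=\sum_{i=\ell_0+1}^{\ell_g}z_i,$$ where the indices satisfy $$0\le\ell_0<\ell_1<\cdots<\ell_g\le r_g<r_{g-1}<\cdots<r_0\le m.$$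
   Context: A ruler of length $t$ with $m+1$ markings is a sequence of integers $0=x_0<x_1<\cdots<x_{m-1}<x_m=t$. It is a $B_2[g]$-set if each positive integer admits at most $g$ representations as a sum of two markings. Representations are unordered and the two markings may be equal: a representation of $n$ is a pair of indices $i\le j$ with $x_i+x_j=n$. $\Delta_{m-1}=\{\mathbf{z}\in\mathbb{R}^m: z_1,\dots,z_m\ge 0,\ \sum_{i=1}^m z_i=1\}$. The interior of $t\Delta_{m-1}$ means its relative interior, $\{\mathbf{z}: z_i>0\text{ for all }i,\ \sum_i z_i=t\}$. Empty sums are $0$. *)

theory Defs
  imports Complex_Main "HOL-Library.FuncSet"
begin

text \<open>
  Finite sequences are extensional functions, so that equality of functions is equality of
  sequences: a ruler is a function on the index set \<open>{0..m}\<close>, and the space of real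
  \<open>m\<close>-vectors with coordinates \<open>z 1, \<dots>, z m\<close> is \<open>{1..m} \<rightarrow>\<^sub>E UNIV\<close>.
\<close>

definition rulers :: "nat \<Rightarrow> int \<Rightarrow> (nat \<Rightarrow> int) set" where
  "rulers m t = {x \<in> {0..m} \<rightarrow>\<^sub>E UNIV. x 0 = 0 \<and> x m = t \<and> strict_mono_on {0..m} x}"

definition representations :: "nat \<Rightarrow> (nat \<Rightarrow> int) \<Rightarrow> int \<Rightarrow> (nat \<times> nat) set" where
  "representations m x n = {(i, j). i \<le> j \<and> j \<le> m \<and> x i + x j = n}"

definition is_B2 :: "nat \<Rightarrow> nat \<Rightarrow> (nat \<Rightarrow> int) \<Rightarrow> bool" where
  "is_B2 g m x \<longleftrightarrow> (\<forall>n>0. card (representations m x n) \<le> g)"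

definition real_space :: "nat \<Rightarrow> (nat \<Rightarrow> real) set" where
  "real_space m = {1..m} \<rightarrow>\<^sub>E UNIV"

definition lattice_points :: "nat \<Rightarrow> (nat \<Rightarrow> real) set" where
  "lattice_points m = {1..m} \<rightarrow>\<^sub>E \<int>"

text \<open>The relative interior of the \<open>t\<close>-th dilate of the standard simplex in
  \<open>real_space m\<close>.\<close>

definition interior_dilated_simplex :: "nat \<Rightarrow> int \<Rightarrow> (nat \<Rightarrow> real) set" where
  "interior_dilated_simplex m t =
     {z \<in> real_space m. (\<forall>i\<in>{1..m}. z i > 0) \<and> (\<Sum>i=1..m. z i) = of_int t}"

definition differences :: "nat \<Rightarrow> (nat \<Rightarrow> int) \<Rightarrow> nat \<Rightarrow> real" where
  "differences m x = (\<lambda>i\<in>{1..m}. of_int (x i - x (i - 1)))"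

definition admissible_indices :: "nat \<Rightarrow> nat \<Rightarrow> (nat \<Rightarrow> nat) \<Rightarrow> (nat \<Rightarrow> nat) \<Rightarrow> bool" where
  "admissible_indices m g l r \<longleftrightarrow>
     (\<forall>k<g. l k < l (Suc k)) \<and> l g \<le> r g \<and> (\<forall>k<g. r (Suc k) < r k) \<and> r 0 \<le> m"

text \<open>The \<open>k\<close>-th member of the chain of equations. For \<open>k = 0\<close> the first sum is empty and
  for \<open>k = g\<close> the second one is, which gives the two one-sum ends of the chain.\<close>

definition chain_term ::
  "nat \<Rightarrow> (nat \<Rightarrow> nat) \<Rightarrow> (nat \<Rightarrow> nat) \<Rightarrow> (nat \<Rightarrow> real) \<Rightarrow> nat \<Rightarrow> real" where
  "chain_term g l r z k = (\<Sum>i = l 0 + 1..l k. z i) + (\<Sum>i = r g + 1..r k. z i)"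

definition chain_subspace ::
  "nat \<Rightarrow> nat \<Rightarrow> (nat \<Rightarrow> nat) \<Rightarrow> (nat \<Rightarrow> nat) \<Rightarrow> (nat \<Rightarrow> real) set" where
  "chain_subspace m g l r =
     {z \<in> real_space m. \<forall>k<g. chain_term g l r z k = chain_term g l r z (Suc k)}"

end

theory Submission
  imports Defs
begin

text \<open>
  Sums of consecutive differences telescope, so the \<open>k\<close>-th member of the chain of equations is
  \<open>x (l k) + x (r k)\<close> up to a summand independent of \<open>k\<close>. Hence a chain holds iff the pairs
  \<open>(l k, r k)\<close>, \<open>k = 0, \<dots>, g\<close>, represent the same number. Conversely, as \<open>x\<close> is strictly
  increasing, the representations of a number are totally ordered: the larger index decreases as
  the smaller one increases. So any \<open>g + 1\<close> of them can be listed as such a chain.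
\<close>

section \<open>Telescoping, and the bijection of all rulers with the interior lattice points\<close>

lemma sum_differences:
  assumes "a \<le> b" "b \<le> m"
  shows "(\<Sum>i = a + 1..b. differences m x i) = of_int (x b - x a)"
  using assms
proof (induction b rule: dec_induct)
  case (step n)
  then show ?case
    by (simp add: differences_def)
qed simp

lemma ruler_less_iff:
  assumes "x \<in> rulers m t" "i \<le> m" "j \<le> m"
  shows "x i < x j \<longleftrightarrow> i < j"
  using assms strict_mono_on_less[of "{0..m}" x i j] by (simp add: rulers_def)

text \<open>Taking partial sums inverts \<open>differences m\<close>: positive coordinates
  correspond to strict monotonicity, and the coordinate sum to the last marking.\<close>

lemma bij_betw_differences:
  "bij_betw (differences m) (rulers m t) (interior_dilated_simplex m t \<inter> lattice_points m)"
proof (rule bij_betw_imageI)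
  show "inj_on (differences m) (rulers m t)"
  proof (rule inj_onI)
    fix x y
    assume x: "x \<in> rulers m t" and y: "y \<in> rulers m t" and eq: "differences m x = differences m y"
    show "x = y"
    proof (rule PiE_ext)
      show "x \<in> {0..m} \<rightarrow>\<^sub>E UNIV" "y \<in> {0..m} \<rightarrow>\<^sub>E UNIV"
        using x y by (auto simp: rulers_def)
      fix i
      assume "i \<in> {0..m}"
      \<comment> \<open>Telescoping from \<open>0\<close> recovers \<open>x i\<close> from the
        differences, because \<open>x 0 = 0\<close>.\<close>
      then show "x i = y i"
        using sum_differences[of 0 i m x] sum_differences[of 0 i m y] eq x y
        by (simp add: rulers_def)
    qed
  qed
next
  show "differences m ` rulers m t = interior_dilated_simplex m t \<inter> lattice_points m"
  proof (intro subset_antisym subsetI)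
    fix z
    assume "z \<in> differences m ` rulers m t"
    then obtain x where x: "x \<in> rulers m t" and z: "z = differences m x"
      by blast
    have "z i > 0" if "i \<in> {1..m}" for i
      using that ruler_less_iff[OF x, of "i - 1" i] by (force simp: z differences_def)
    moreover have "(\<Sum>i=1..m. z i) = of_int t"
      using sum_differences[of 0 m m x] x by (simp add: z rulers_def)
    ultimately show "z \<in> interior_dilated_simplex m t \<inter> lattice_points m"
      by (auto simp: z interior_dilated_simplex_def lattice_points_def real_space_def
          differences_def)
  next
    fix z
    assume z: "z \<in> interior_dilated_simplex m t \<inter> lattice_points m"
    \<comment> \<open>The preimage is the sequence of partial sums. The floor only changes the type
      from \<open>real\<close> to \<open>int\<close>, since each \<open>z j\<close> is an
      integer.\<close>
    define x where "x = (\<lambda>i\<in>{0..m}. \<Sum>j=1..i. \<lfloor>z j\<rfloor>)"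
    have z_int: "of_int \<lfloor>z i\<rfloor> = z i" and z_pos: "z i > 0" if "i \<in> {1..m}" for i
      using z that by (auto simp: interior_dilated_simplex_def lattice_points_def PiE_def Pi_def)
    have diff: "x i - x (i - 1) = \<lfloor>z i\<rfloor>" if "i \<in> {1..m}" for i
      using that by (cases i) (auto simp: x_def)
    \<comment> \<open>Once this is known, monotonicity and \<open>x m = t\<close> follow by
      telescoping sums of \<open>z\<close>.\<close>
    have differences_x: "differences m x = z"
    proof (rule PiE_ext)
      show "differences m x \<in> {1..m} \<rightarrow>\<^sub>E UNIV" "z \<in> {1..m} \<rightarrow>\<^sub>E UNIV"
        using z by (auto simp: differences_def interior_dilated_simplex_def real_space_def)
      fix i
      assume i: "i \<in> {1..m}"
      then have "differences m x i = of_int (x i - x (i - 1))"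
        by (simp add: differences_def)
      with i show "differences m x i = z i"
        by (simp only: diff z_int)
    qed
    have "strict_mono_on {0..m} x"
    proof (rule strict_mono_onI)
      fix a b
      assume "a \<in> {0..m}" "b \<in> {0..m}" "a < b"
      then have "(\<Sum>i = a + 1..b. z i) > 0"
        using z_pos by (intro sum_pos) auto
      then show "x a < x b"
        using sum_differences[of a b m x] \<open>a < b\<close> \<open>b \<in> {0..m}\<close> by (simp add: differences_x)
    qed
    moreover have "x 0 = 0"
      by (simp add: x_def)
    moreover have "x m = t"
      using sum_differences[of 0 m m x] z \<open>x 0 = 0\<close>
      by (simp add: differences_x interior_dilated_simplex_def)
    moreover have "x \<in> {0..m} \<rightarrow>\<^sub>E UNIV"
      by (simp add: x_def)
    ultimately have "x \<in> rulers m t"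
      by (simp add: rulers_def)
    then show "z \<in> differences m ` rulers m t"
      using differences_x by blast
  qed
qed

section \<open>Chains of equations as equalities between sums of two markings\<close>

lemma admissible_indices_less:
  assumes "admissible_indices m g l r" "i < j" "j \<le> g"
  shows "l i < l j" "r j < r i"
proof -
  have "l i < l j \<and> r j < r i"
    using assms(2,3)
  proof (induction j)
    case (Suc j)
    then have "l j < l (Suc j)" "r (Suc j) < r j"
      using assms(1) by (auto simp: admissible_indices_def)
    with Suc show ?case
      by (cases "i = j") auto
  qed simp
  then show "l i < l j" "r j < r i"
    by simp_all
qed

lemma admissible_indices_bounds:
  assumes "admissible_indices m g l r" "k \<le> g"
  shows "l 0 \<le> l k" "l k \<le> l g" "r g \<le> r k" "r k \<le> r 0"
proof -
  show "l 0 \<le> l k" "r k \<le> r 0"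
    using admissible_indices_less[OF assms(1), of 0 k] assms(2) by (cases "k = 0"; simp)+
  show "l k \<le> l g" "r g \<le> r k"
    using admissible_indices_less[OF assms(1), of k g] assms(2) by (cases "k = g"; simp)+
qed

lemma chain_term_differences:
  assumes "admissible_indices m g l r" "k \<le> g"
  shows "chain_term g l r (differences m x) k
    = of_int (x (l k) + x (r k) - (x (l 0) + x (r g)))"
proof -
  have "l g \<le> r g" "r 0 \<le> m"
    using assms(1) by (auto simp: admissible_indices_def)
  then show ?thesis
    using admissible_indices_bounds[OF assms] sum_differences[of "l 0" "l k" m x]
      sum_differences[of "r g" "r k" m x]
    by (simp add: chain_term_def)
qed

lemma differences_in_chain_subspace_iff:
  assumes "admissible_indices m g l r"
  shows "differences m x \<in> chain_subspace m g l r
    \<longleftrightarrow> (\<forall>k\<le>g. x (l k) + x (r k) = x (l 0) + x (r 0))"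
proof -
  have "differences m x \<in> chain_subspace m g l r
    \<longleftrightarrow> (\<forall>k<g. x (l k) + x (r k) = x (l (Suc k)) + x (r (Suc k)))"
  proof -
    have "differences m x \<in> real_space m"
      by (auto simp: differences_def real_space_def)
    \<comment> \<open>Both members carry the same offset \<open>x (l 0) + x (r g)\<close>, which
      cancels.\<close>
    moreover have "chain_term g l r (differences m x) k
        = chain_term g l r (differences m x) (Suc k)
      \<longleftrightarrow> x (l k) + x (r k) = x (l (Suc k)) + x (r (Suc k))" if "k < g" for k
      using that by (subst (1 2) chain_term_differences[OF assms]) auto
    ultimately show ?thesis
      by (simp add: chain_subspace_def)
  qed
  also have "\<dots> \<longleftrightarrow> (\<forall>k\<le>g. x (l k) + x (r k) = x (l 0) + x (r 0))"
  proof
    assume step: "\<forall>k<g. x (l k) + x (r k) = x (l (Suc k)) + x (r (Suc k))"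
    show "\<forall>k\<le>g. x (l k) + x (r k) = x (l 0) + x (r 0)"
    proof (intro allI impI)
      fix k
      assume "k \<le> g"
      then show "x (l k) + x (r k) = x (l 0) + x (r 0)"
      proof (induction k)
        case (Suc k)
        then have "k < g" "x (l k) + x (r k) = x (l 0) + x (r 0)"
          by simp_all
        with step show ?case by metis
      qed simp
    qed
  next
    assume const: "\<forall>k\<le>g. x (l k) + x (r k) = x (l 0) + x (r 0)"
    show "\<forall>k<g. x (l k) + x (r k) = x (l (Suc k)) + x (r (Suc k))"
    proof (intro allI impI)
      fix k
      assume "k < g"
      then have "k \<le> g" "Suc k \<le> g"
        by simp_all
      with const show "x (l k) + x (r k) = x (l (Suc k)) + x (r (Suc k))"
        by metis
    qed
  qed
  finally show ?thesis .
qed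

section \<open>Representations of a fixed number and index chains\<close>

lemma finite_representations: "finite (representations m x n)"
  by (rule finite_subset[of _ "{0..m} \<times> {0..m}"]) (auto simp: representations_def)

text \<open>Both pairs have sum \<open>n\<close>, so \<open>x i < x i'\<close> forces
  \<open>x j' < x j\<close>.\<close>

lemma representation_snd_less:
  assumes "x \<in> rulers m t" "(i, j) \<in> representations m x n" "(i', j') \<in> representations m x n"
    and "i < i'"
  shows "j' < j"
  using assms ruler_less_iff[of x m t i i'] ruler_less_iff[of x m t j' j]
  by (auto simp: representations_def)

text \<open>The first index fixes \<open>x j\<close>, and \<open>x\<close> is injective.
  Representations can therefore be counted, and sorted, by their first indices.\<close>

lemma inj_on_fst_representations:
  assumes "x \<in> rulers m t"
  shows "inj_on fst (representations m x n)"
proof -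
  have "j = j'" if "j \<le> m" "j' \<le> m" "x j = x j'" for j j'
    using that ruler_less_iff[OF assms, of j j'] ruler_less_iff[OF assms, of j' j] by auto
  then show ?thesis
    by (auto simp: inj_on_def representations_def)
qed

lemma chain_of_many_representations:
  assumes x: "x \<in> rulers m t" and card: "g < card (representations m x n)"
  obtains l r where "admissible_indices m g l r"
    and "\<And>k. k \<le> g \<Longrightarrow> (l k, r k) \<in> representations m x n"
proof -
  define R where "R = representations m x n"
  \<comment> \<open>The left indices of the chain are the \<open>g + 1\<close> smallest first
    indices in increasing order; \<open>r k\<close> is the partner of \<open>xs ! k\<close>.\<close>
  define xs where "xs = sorted_list_of_set (fst ` R)"
  define r where "r = (\<lambda>k. SOME j. (xs ! k, j) \<in> R)"
  have "finite (fst ` R)"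
    by (simp add: R_def finite_representations)
  moreover have "card (fst ` R) = card R"
    unfolding R_def by (rule card_image[OF inj_on_fst_representations[OF x]])
  ultimately have len: "g < length xs" and set: "set xs = fst ` R"
    using card by (simp_all add: xs_def R_def)
  have in_R: "(xs ! k, r k) \<in> R" if "k \<le> g" for k
  proof -
    have "xs ! k \<in> fst ` R"
      using that len set by (metis le_less_trans nth_mem)
    then have "\<exists>j. (xs ! k, j) \<in> R"
      by force
    then show ?thesis
      unfolding r_def by (rule someI_ex)
  qed
  have l_mono: "xs ! k < xs ! Suc k" if "k < g" for k
    using that len sorted_wrt_nth_less[OF strict_sorted_list_of_set, of k "Suc k" "fst ` R"]
    by (simp add: xs_def)
  have r_mono: "r (Suc k) < r k" if "k < g" for k
    using representation_snd_less[OF x _ _ l_mono[OF that], of "r k" n "r (Suc k)"]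
      in_R[of k] in_R[of "Suc k"] that by (simp add: R_def)
  \<comment> \<open>The convention \<open>i \<le> j\<close> at the innermost pair
    \<open>k = g\<close> closes the chain in the middle; the outermost pair \<open>k = 0\<close>
    gives the bound \<open>m\<close>.\<close>
  have "xs ! g \<le> r g" "r 0 \<le> m"
    using in_R[of g] in_R[of 0] by (auto simp: R_def representations_def)
  then have "admissible_indices m g ((!) xs) r"
    using l_mono r_mono by (simp add: admissible_indices_def)
  then show thesis
    using that in_R by (simp add: R_def)
qed

lemma many_representations_of_chain:
  assumes l_r: "admissible_indices m g l r" and const: "\<And>k. k \<le> g \<Longrightarrow> x (l k) + x (r k) = n"
  shows "g < card (representations m x n)"
proof -
  \<comment> \<open>As \<open>l\<close> is strictly increasing up to \<open>g\<close>, the chain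
    yields \<open>g + 1\<close> distinct pairs.\<close>
  have "inj_on (\<lambda>k. (l k, r k)) {..g}"
    using admissible_indices_less(1)[OF l_r] by (intro linorder_inj_onI) force+
  then have "Suc g = card ((\<lambda>k. (l k, r k)) ` {..g})"
    by (simp add: card_image)
  also have "\<dots> \<le> card (representations m x n)"
  proof (intro card_mono finite_representations image_subsetI)
    fix k
    assume "k \<in> {..g}"
    moreover have "l g \<le> r g" "r 0 \<le> m"
      using l_r by (auto simp: admissible_indices_def)
    ultimately show "(l k, r k) \<in> representations m x n"
      using admissible_indices_bounds[OF l_r, of k] const[of k]
      by (auto simp: representations_def)
  qed
  finally show ?thesis by simp
qed

lemma is_B2_iff:
  assumes x: "x \<in> rulers m t" and "g \<ge> 1"
  shows "is_B2 g m x
    \<longleftrightarrow> \<not> (\<exists>l r. admissible_indices m g l r \<and> differences m x \<in> chain_subspace m g l r)"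
proof -
  have "is_B2 g m x" if no_chain:
    "\<not> (\<exists>l r. admissible_indices m g l r \<and> differences m x \<in> chain_subspace m g l r)"
  proof (rule ccontr)
    assume "\<not> is_B2 g m x"
    then obtain n where "g < card (representations m x n)"
      by (auto simp: is_B2_def not_le)
    with x obtain l r where l_r: "admissible_indices m g l r"
      and "\<And>k. k \<le> g \<Longrightarrow> (l k, r k) \<in> representations m x n"
      by (rule chain_of_many_representations) blast
    then have "\<forall>k\<le>g. x (l k) + x (r k) = x (l 0) + x (r 0)"
      by (simp add: representations_def)
    with no_chain l_r show False
      using differences_in_chain_subspace_iff[OF l_r] by blast
  qed
  moreover have False if "is_B2 g m x" and l_r: "admissible_indices m g l r"
    and chain: "differences m x \<in> chain_subspace m g l r" for l r
  proof -
    define n where "n = x (l 0) + x (r 0)"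
    have "g < card (representations m x n)"
      using chain many_representations_of_chain[OF l_r]
      unfolding n_def differences_in_chain_subspace_iff[OF l_r] by blast
    \<comment> \<open>\<open>is_B2\<close> only restricts positive numbers. Since
      \<open>g \<ge> 1\<close>, we have \<open>l 0 < l g \<le> r g < r 0\<close>, so
      \<open>x (r 0) > 0\<close>, while \<open>x (l 0) \<ge> 0\<close>.\<close>
    moreover have "n > 0"
    proof -
      have "r g < r 0" "l 0 < l g"
        using admissible_indices_less[OF l_r, of 0 g] \<open>g \<ge> 1\<close> by simp_all
      moreover have "l g \<le> r g" "r 0 \<le> m"
        using l_r by (auto simp: admissible_indices_def)
      ultimately have "0 < r 0" "l 0 \<le> m" "r 0 \<le> m"
        by linarith+
      then show ?thesis
        using ruler_less_iff[OF x, of 0 "r 0"] ruler_less_iff[OF x, of "l 0" 0] x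
        by (simp add: n_def rulers_def)
    qed
    ultimately show False
      using \<open>is_B2 g m x\<close> unfolding is_B2_def by (meson not_le)
  qed
  ultimately show ?thesis by blast
qed

theorem proposition3p6:
  fixes m g :: nat and t :: int
  assumes "m \<ge> 1" and "g \<ge> 1" and "t \<ge> 1"
  shows "bij_betw (differences m)
    {x \<in> rulers m t. is_B2 g m x}
    {z \<in> interior_dilated_simplex m t \<inter> lattice_points m.
       \<not> (\<exists>l r. admissible_indices m g l r \<and> z \<in> chain_subspace m g l r)}"
  \<comment> \<open>\<open>is_B2_iff\<close> matches the two side conditions pointwise, so the
    bijection restricts to the two subsets.\<close>
  using bij_betw_differences by (rule bij_betw_Collect) (use is_B2_iff[OF _ assms(2)] in blast)

end
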